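(* Let $G$ be a finite group. A linear map $L:\mathbb CG\to\mathbb CG$ is a left $D^\vee(G)$-comodule map with respect to the coaction $\Delta_Lg=\sum_{f\in G}\delta_f\otimes f^{-1}gf\otimes f^{-1}gf$ if and only if the eigenspaces of $L$ are direct sums of spaces of the form $\mathbb C\mathcal C$ spanned by the conjugacy classes $\mathcal C$ of $G$.
   Context: $\mathbb CG$ is the group algebra and $\mathbb C\mathcal C\subseteq\mathbb CG$ is the linear span of the elements of $\mathcal C$. $D^\vee(G)$ is the Hopf algebra on $\mathbb C(G)\otimes\mathbb CG$ (with $\mathbb C(G)$ the functions on $G$ with basis $\delta_g$) with tensor product algebra and counit, $\Delta(\delta_g\otimes h)=\sum_f\delta_f\otimes f^{-1}ghg^{-1}f\otimes\delta_{f^{-1}g}\otimes h$, $S(\delta_g\otimes h)=\delta_{g^{-1}}\otimes gh^{-1}g^{-1}$.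
   Formalization: The right-hand side also requires that CG be the direct sum of the eigenspaces of L (L diagonalizable); without it the "if" direction fails, e.g. G = {e,s} of order 2 with L(e)=0, L(s)=e. *)

theory Defs
  imports Complex_Main "HOL-Library.Function_Algebras" "HOL-Algebra.Group_Action"
begin

section \<open>Complex vector spaces with a basis\<close>

text \<open>
  A vector in the space with finite basis \<open>B\<close> is represented by its coordinate function, so all
  spaces below are subspaces of \<open>'b \<Rightarrow> complex\<close> with pointwise operations.
  The tensor product of the spaces with bases \<open>B\<close> and \<open>D\<close> is the space with basis \<open>B \<times> D\<close>.
\<close>

definition cscale :: "complex \<Rightarrow> ('b \<Rightarrow> complex) \<Rightarrow> 'b \<Rightarrow> complex" where
  "cscale c v = (\<lambda>x. c * v x)"

interpretation cfun: vector_space cscale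
  by unfold_locales (auto simp: cscale_def fun_eq_iff algebra_simps)

definition bas :: "'b \<Rightarrow> 'b \<Rightarrow> complex" where
  "bas b = (\<lambda>x. if x = b then 1 else 0)"

definition cspan :: "'b set \<Rightarrow> ('b \<Rightarrow> complex) set" where
  "cspan B = cfun.span (bas ` B)"

definition linear_map ::
  "(complex \<Rightarrow> 'v \<Rightarrow> 'v) \<Rightarrow> 'v::ab_group_add set \<Rightarrow> (complex \<Rightarrow> 'w \<Rightarrow> 'w) \<Rightarrow> 'w::ab_group_add set
    \<Rightarrow> ('v \<Rightarrow> 'w) \<Rightarrow> bool" where
  "linear_map s V t W T \<longleftrightarrow>
     T \<in> V \<rightarrow> W \<and>
     (\<forall>v\<in>V. \<forall>w\<in>V. T (v + w) = T v + T w) \<and>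
     (\<forall>c. \<forall>v\<in>V. T (s c v) = t c (T v))"

definition lin_ext :: "'b set \<Rightarrow> ('b \<Rightarrow> 'd \<Rightarrow> complex) \<Rightarrow> ('b \<Rightarrow> complex) \<Rightarrow> 'd \<Rightarrow> complex" where
  "lin_ext B \<phi> v = (\<Sum>b\<in>B. cscale (v b) (\<phi> b))"

definition tensor :: "('b \<Rightarrow> complex) \<Rightarrow> ('d \<Rightarrow> complex) \<Rightarrow> 'b \<times> 'd \<Rightarrow> complex" where
  "tensor v w = (\<lambda>(x, y). v x * w y)"

definition tensor_map ::
  "'b set \<Rightarrow> 'd set \<Rightarrow> (('b \<Rightarrow> complex) \<Rightarrow> 'b2 \<Rightarrow> complex) \<Rightarrow> (('d \<Rightarrow> complex) \<Rightarrow> 'd2 \<Rightarrow> complex)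
    \<Rightarrow> ('b \<times> 'd \<Rightarrow> complex) \<Rightarrow> 'b2 \<times> 'd2 \<Rightarrow> complex" where
  "tensor_map B D S T = lin_ext (B \<times> D) (\<lambda>(b, d). tensor (S (bas b)) (T (bas d)))"

definition tensor_assoc :: "(('b \<times> 'd) \<times> 'e \<Rightarrow> complex) \<Rightarrow> 'b \<times> 'd \<times> 'e \<Rightarrow> complex" where
  "tensor_assoc v = (\<lambda>(x, y, z). v ((x, y), z))"

text \<open>The following two maps incorporate the identifications of \<open>\<complex> \<otimes> W\<close> and \<open>W \<otimes> \<complex>\<close> with \<open>W\<close>.\<close>

definition form_tensor_id ::
  "'b set \<Rightarrow> 'd set \<Rightarrow> (('b \<Rightarrow> complex) \<Rightarrow> complex) \<Rightarrow> ('b \<times> 'd \<Rightarrow> complex) \<Rightarrow> 'd \<Rightarrow> complex" where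
  "form_tensor_id B D e = lin_ext (B \<times> D) (\<lambda>(b, d). cscale (e (bas b)) (bas d))"

definition id_tensor_form ::
  "'d set \<Rightarrow> 'b set \<Rightarrow> (('b \<Rightarrow> complex) \<Rightarrow> complex) \<Rightarrow> ('d \<times> 'b \<Rightarrow> complex) \<Rightarrow> 'd \<Rightarrow> complex" where
  "id_tensor_form D B e = lin_ext (D \<times> B) (\<lambda>(d, b). cscale (e (bas b)) (bas d))"

definition is_direct_sum :: "'i set \<Rightarrow> ('i \<Rightarrow> ('b \<Rightarrow> complex) set) \<Rightarrow> ('b \<Rightarrow> complex) set \<Rightarrow> bool" where
  "is_direct_sum I V E \<longleftrightarrow>
     finite I \<and> (\<forall>i\<in>I. cfun.subspace (V i)) \<and>
     E = {\<Sum>i\<in>I. w i | w. \<forall>i\<in>I. w i \<in> V i} \<and>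
     (\<forall>w. (\<forall>i\<in>I. w i \<in> V i) \<and> (\<Sum>i\<in>I. w i) = 0 \<longrightarrow> (\<forall>i\<in>I. w i = 0))"

definition eigenspace :: "('b \<Rightarrow> complex) set \<Rightarrow> (('b \<Rightarrow> complex) \<Rightarrow> 'b \<Rightarrow> complex) \<Rightarrow> complex
    \<Rightarrow> ('b \<Rightarrow> complex) set" where
  "eigenspace V L c = {v \<in> V. L v = cscale c v}"

definition eigenvalues :: "('b \<Rightarrow> complex) set \<Rightarrow> (('b \<Rightarrow> complex) \<Rightarrow> 'b \<Rightarrow> complex) \<Rightarrow> complex set" where
  "eigenvalues V L = {c. \<exists>v\<in>eigenspace V L c. v \<noteq> 0}"


section \<open>Coalgebras and comodules\<close>

record 'b coalgebra_data =
  cbasis :: "'b set"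
  comult :: "('b \<Rightarrow> complex) \<Rightarrow> 'b \<times> 'b \<Rightarrow> complex"
  counit :: "('b \<Rightarrow> complex) \<Rightarrow> complex"

definition coalgebra :: "'b coalgebra_data \<Rightarrow> bool" where
  "coalgebra C \<longleftrightarrow>
     finite (cbasis C) \<and>
     linear_map cscale (cspan (cbasis C)) cscale (cspan (cbasis C \<times> cbasis C)) (comult C) \<and>
     linear_map cscale (cspan (cbasis C)) (*) UNIV (counit C) \<and>
     (\<forall>v\<in>cspan (cbasis C).
        tensor_assoc (tensor_map (cbasis C) (cbasis C) (comult C) id (comult C v)) =
          tensor_map (cbasis C) (cbasis C) id (comult C) (comult C v) \<and>
        form_tensor_id (cbasis C) (cbasis C) (counit C) (comult C v) = v \<and>
        id_tensor_form (cbasis C) (cbasis C) (counit C) (comult C v) = v)"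

definition left_comodule ::
  "'b coalgebra_data \<Rightarrow> 'm set \<Rightarrow> (('m \<Rightarrow> complex) \<Rightarrow> 'b \<times> 'm \<Rightarrow> complex) \<Rightarrow> bool" where
  "left_comodule C M \<beta> \<longleftrightarrow>
     coalgebra C \<and> finite M \<and>
     linear_map cscale (cspan M) cscale (cspan (cbasis C \<times> M)) \<beta> \<and>
     (\<forall>v\<in>cspan M.
        tensor_assoc (tensor_map (cbasis C) M (comult C) id (\<beta> v)) =
          tensor_map (cbasis C) M id \<beta> (\<beta> v) \<and>
        form_tensor_id (cbasis C) M (counit C) (\<beta> v) = v)"

definition left_comodule_map ::
  "'b coalgebra_data \<Rightarrow> 'm set \<Rightarrow> (('m \<Rightarrow> complex) \<Rightarrow> 'b \<times> 'm \<Rightarrow> complex)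
    \<Rightarrow> 'n set \<Rightarrow> (('n \<Rightarrow> complex) \<Rightarrow> 'b \<times> 'n \<Rightarrow> complex)
    \<Rightarrow> (('m \<Rightarrow> complex) \<Rightarrow> 'n \<Rightarrow> complex) \<Rightarrow> bool" where
  "left_comodule_map C M \<beta> N \<gamma> L \<longleftrightarrow>
     left_comodule C M \<beta> \<and> left_comodule C N \<gamma> \<and>
     linear_map cscale (cspan M) cscale (cspan N) L \<and>
     (\<forall>v\<in>cspan M. tensor_map (cbasis C) M id L (\<beta> v) = \<gamma> (L v))"


section \<open>The coalgebra \<open>D\<^sup>\<or>(G)\<close> and its coaction on the group algebra\<close>

text \<open>
  The basis element \<open>\<delta>\<^sub>g \<otimes> h\<close> is \<open>tensor (bas g) (bas h) = bas (g, h)\<close>. Comodules over a Hopf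
  algebra are comodules over the underlying coalgebra, so the product, unit and antipode are
  omitted. The counit is the tensor product of \<open>\<delta>\<^sub>g \<mapsto> (if g = 1 then 1 else 0)\<close> and \<open>h \<mapsto> 1\<close>.
\<close>

definition D_dual :: "('a, 'r) monoid_scheme \<Rightarrow> ('a \<times> 'a) coalgebra_data" where
  "D_dual G = \<lparr>
     cbasis = carrier G \<times> carrier G,
     comult = lin_ext (carrier G \<times> carrier G) (\<lambda>(g, h). \<Sum>f\<in>carrier G.
       tensor
         (tensor (bas f)
           (bas (inv\<^bsub>G\<^esub> f \<otimes>\<^bsub>G\<^esub> g \<otimes>\<^bsub>G\<^esub> h \<otimes>\<^bsub>G\<^esub> inv\<^bsub>G\<^esub> g \<otimes>\<^bsub>G\<^esub> f)))
         (tensor (bas (inv\<^bsub>G\<^esub> f \<otimes>\<^bsub>G\<^esub> g)) (bas h))),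
     counit = (\<lambda>v. \<Sum>(g, h)\<in>carrier G \<times> carrier G. v (g, h) * (if g = \<one>\<^bsub>G\<^esub> then 1 else 0)) \<rparr>"

definition conj_coaction ::
  "('a, 'r) monoid_scheme \<Rightarrow> ('a \<Rightarrow> complex) \<Rightarrow> ('a \<times> 'a) \<times> 'a \<Rightarrow> complex" where
  "conj_coaction G = lin_ext (carrier G) (\<lambda>g. \<Sum>f\<in>carrier G.
     tensor
       (tensor (bas f) (bas (inv\<^bsub>G\<^esub> f \<otimes>\<^bsub>G\<^esub> g \<otimes>\<^bsub>G\<^esub> f)))
       (bas (inv\<^bsub>G\<^esub> f \<otimes>\<^bsub>G\<^esub> g \<otimes>\<^bsub>G\<^esub> f)))"

definition conj_classes :: "('a, 'r) monoid_scheme \<Rightarrow> 'a set set" where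
  "conj_classes G = orbits G (carrier G) (\<lambda>f g. f \<otimes>\<^bsub>G\<^esub> g \<otimes>\<^bsub>G\<^esub> inv\<^bsub>G\<^esub> f)"


section \<open>\<open>D\<^sup>\<or>(G)\<close> is a coalgebra and the coaction makes the group algebra a comodule\<close>

lemma sum_fun_app: "(\<Sum>i\<in>I. f i) x = (\<Sum>i\<in>I. f i x)"
  by (induction I rule: infinite_finite_induct) auto

lemma subspace_supp: "cfun.subspace {v. \<forall>x. x \<notin> B \<longrightarrow> v x = (0::complex)}"
  by (auto simp: cfun.subspace_def cscale_def)

lemma expand_bas:
  assumes "finite B" "\<forall>x. x \<notin> B \<longrightarrow> v x = 0"
  shows "v = (\<Sum>b\<in>B. cscale (v b) (bas b))"
proof
  fix x
  have "(\<Sum>b\<in>B. v b * (if x = b then 1 else 0)) = (\<Sum>b\<in>B. if x = b then v b else 0)"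
    by (rule sum.cong) auto
  also have "\<dots> = v x" using assms by (simp add: sum.delta')
  finally show "v x = (\<Sum>b\<in>B. cscale (v b) (bas b)) x"
    by (simp add: sum_fun_app cscale_def bas_def)
qed

lemma cspan_iff:
  assumes "finite B"
  shows "v \<in> cspan B \<longleftrightarrow> (\<forall>x. x \<notin> B \<longrightarrow> v x = 0)"
proof
  assume "v \<in> cspan B"
  moreover have "cspan B \<subseteq> {v. \<forall>x. x \<notin> B \<longrightarrow> v x = 0}"
    unfolding cspan_def by (rule cfun.span_minimal[OF _ subspace_supp]) (auto simp: bas_def)
  ultimately show "\<forall>x. x \<notin> B \<longrightarrow> v x = 0" by blast
next
  assume "\<forall>x. x \<notin> B \<longrightarrow> v x = 0"
  then have "v = (\<Sum>b\<in>B. cscale (v b) (bas b))" by (rule expand_bas[OF assms])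
  also have "\<dots> \<in> cspan B" unfolding cspan_def
    by (intro cfun.span_sum cfun.span_scale cfun.span_base) auto
  finally show "v \<in> cspan B" .
qed

lemma bas_in_cspan: "b \<in> B \<Longrightarrow> bas b \<in> cspan B"
  by (simp add: cspan_def cfun.span_base)

lemma tensor_bas: "tensor (bas b) (bas d) = bas (b, d)"
  by (auto simp: tensor_def bas_def fun_eq_iff)

lemma lin_ext_add: "lin_ext B \<phi> (v + w) = lin_ext B \<phi> v + lin_ext B \<phi> w"
  by (simp add: lin_ext_def fun_eq_iff sum_fun_app cscale_def distrib_right sum.distrib)

lemma lin_ext_scale: "lin_ext B \<phi> (cscale c v) = cscale c (lin_ext B \<phi> v)"
  by (simp add: lin_ext_def fun_eq_iff sum_fun_app cscale_def sum_distrib_left mult.assoc)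

lemma lin_ext_zero: "lin_ext B \<phi> 0 = 0"
  by (simp add: lin_ext_def fun_eq_iff sum_fun_app cscale_def)

lemma lin_ext_sum: "lin_ext B \<phi> (\<Sum>i\<in>I. f i) = (\<Sum>i\<in>I. lin_ext B \<phi> (f i))"
  by (induction I rule: infinite_finite_induct) (simp_all only: sum.infinite sum.empty sum.insert lin_ext_add lin_ext_zero
      not_False_eq_True)

lemma lin_ext_bas:
  assumes "finite B" "b \<in> B"
  shows "lin_ext B \<phi> (bas b) = \<phi> b"
proof
  fix x
  have "(\<Sum>a\<in>B. (if a = b then 1 else 0) * \<phi> a x) = (\<Sum>a\<in>B. if a = b then \<phi> a x else 0)"
    by (rule sum.cong) auto
  also have "\<dots> = \<phi> b x" using assms by simp
  finally show "lin_ext B \<phi> (bas b) x = \<phi> b x"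
    by (simp add: lin_ext_def sum_fun_app cscale_def bas_def)
qed

lemma linear_map_lin_ext:
  assumes "finite B" "\<And>b. b \<in> B \<Longrightarrow> \<phi> b \<in> cspan D"
  shows "linear_map cscale (cspan B) cscale (cspan D) (lin_ext B \<phi>)"
  unfolding linear_map_def
proof (intro conjI ballI allI funcsetI)
  fix v show "lin_ext B \<phi> v \<in> cspan D"
    using assms(2) unfolding lin_ext_def cspan_def
    by (intro cfun.span_sum cfun.span_scale) auto
qed (simp_all add: lin_ext_add lin_ext_scale)

lemma tensor_sum_left: "tensor (\<Sum>i\<in>I. f i) w = (\<Sum>i\<in>I. tensor (f i) w)"
  by (auto simp: tensor_def fun_eq_iff sum_fun_app sum_distrib_right)

lemma tensor_sum_right: "tensor v (\<Sum>i\<in>I. f i) = (\<Sum>i\<in>I. tensor v (f i))"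
  by (auto simp: tensor_def fun_eq_iff sum_fun_app sum_distrib_left)

lemma tensor_map_sum: "tensor_map B D S T (\<Sum>i\<in>I. f i) = (\<Sum>i\<in>I. tensor_map B D S T (f i))"
  by (simp add: tensor_map_def lin_ext_sum)

lemma tensor_map_bas:
  "finite B \<Longrightarrow> finite D \<Longrightarrow> b \<in> B \<Longrightarrow> d \<in> D \<Longrightarrow>
   tensor_map B D S T (bas (b, d)) = tensor (S (bas b)) (T (bas d))"
  by (simp add: tensor_map_def lin_ext_bas)

lemma form_tensor_id_sum:
  "form_tensor_id B D e (\<Sum>i\<in>I. f i) = (\<Sum>i\<in>I. form_tensor_id B D e (f i))"
  by (simp add: form_tensor_id_def lin_ext_sum)

lemma id_tensor_form_sum:
  "id_tensor_form B D e (\<Sum>i\<in>I. f i) = (\<Sum>i\<in>I. id_tensor_form B D e (f i))"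
  by (simp add: id_tensor_form_def lin_ext_sum)

lemma form_tensor_id_bas:
  "finite B \<Longrightarrow> finite D \<Longrightarrow> b \<in> B \<Longrightarrow> d \<in> D \<Longrightarrow>
   form_tensor_id B D e (bas (b, d)) = cscale (e (bas b)) (bas d)"
  by (simp add: form_tensor_id_def lin_ext_bas)

lemma id_tensor_form_bas:
  "finite B \<Longrightarrow> finite D \<Longrightarrow> b \<in> B \<Longrightarrow> d \<in> D \<Longrightarrow>
   id_tensor_form D B e (bas (d, b)) = cscale (e (bas b)) (bas d)"
  by (simp add: id_tensor_form_def lin_ext_bas)

lemma tensor_assoc_sum: "tensor_assoc (\<Sum>i\<in>I. f i) = (\<Sum>i\<in>I. tensor_assoc (f i))"
  by (auto simp: tensor_assoc_def fun_eq_iff sum_fun_app)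

lemma tensor_assoc_bas: "tensor_assoc (bas ((x, y), z)) = bas (x, y, z)"
  by (auto simp: tensor_assoc_def bas_def fun_eq_iff)

definition lin :: "(('b \<Rightarrow> complex) \<Rightarrow> 'd \<Rightarrow> complex) \<Rightarrow> bool" where
  "lin T \<longleftrightarrow> (\<forall>v w. T (v + w) = T v + T w) \<and> (\<forall>c v. T (cscale c v) = cscale c (T v))"

lemma lin_comp: "lin S \<Longrightarrow> lin T \<Longrightarrow> lin (\<lambda>v. S (T v))"
  by (simp add: lin_def)

lemma lin_id: "lin (\<lambda>v. v)"
  by (simp add: lin_def)

lemma lin_lin_ext: "lin (lin_ext B \<phi>)"
  by (simp add: lin_def lin_ext_add lin_ext_scale)

lemma lin_tensor_map: "lin (tensor_map B D S T)"
  by (simp add: tensor_map_def lin_lin_ext)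

lemma lin_form_tensor_id: "lin (form_tensor_id B D e)"
  by (simp add: form_tensor_id_def lin_lin_ext)

lemma lin_id_tensor_form: "lin (id_tensor_form B D e)"
  by (simp add: id_tensor_form_def lin_lin_ext)

lemma lin_tensor_assoc: "lin tensor_assoc"
  by (auto simp: lin_def tensor_assoc_def fun_eq_iff cscale_def)

lemma lin_eqI:
  assumes S: "lin S" and T: "lin T" and eq: "\<And>b. b \<in> B \<Longrightarrow> S (bas b) = T (bas b)"
    and v: "v \<in> cspan B"
  shows "S v = T v"
proof -
  have "S (cscale 0 0) = cscale 0 (S 0)" "T (cscale 0 0) = cscale 0 (T 0)"
    using S T unfolding lin_def by blast+
  then have zero: "S 0 = 0" "T 0 = 0" by simp_all
  have "cfun.subspace {v. S v = T v}"
    using S T zero by (auto simp: cfun.subspace_def lin_def)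
  then have "cspan B \<subseteq> {v. S v = T v}"
    unfolding cspan_def using eq by (intro cfun.span_minimal) auto
  then show ?thesis using v by blast
qed

context group
begin

lemma D_dual_simps:
  "cbasis (D_dual G) = carrier G \<times> carrier G"
  "lin (comult (D_dual G))"
  by (simp_all add: D_dual_def lin_lin_ext)

lemma comult_D_dual_bas:
  assumes "finite (carrier G)" "g \<in> carrier G" "h \<in> carrier G"
  shows "comult (D_dual G) (bas (g, h)) =
    (\<Sum>f\<in>carrier G. bas ((f, inv f \<otimes> g \<otimes> h \<otimes> inv g \<otimes> f), (inv f \<otimes> g, h)))"
  using assms by (simp add: D_dual_def lin_ext_bas tensor_bas)

lemma counit_D_dual_bas:
  assumes "finite (carrier G)" "g \<in> carrier G" "h \<in> carrier G"
  shows "counit (D_dual G) (bas (g, h)) = (if g = \<one> then 1 else 0)"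
proof -
  have "counit (D_dual G) (bas (g, h)) =
      (\<Sum>p\<in>carrier G \<times> carrier G. if p = (g, h) then (if g = \<one> then 1 else 0) else 0)"
    unfolding D_dual_def coalgebra_data.simps by (rule sum.cong) (simp_all add: bas_def split: prod.splits)
  then show ?thesis using assms by simp
qed

lemma conj_coaction_bas:
  assumes "finite (carrier G)" "g \<in> carrier G"
  shows "conj_coaction G (bas g) =
    (\<Sum>f\<in>carrier G. bas ((f, inv f \<otimes> g \<otimes> f), inv f \<otimes> g \<otimes> f))"
  using assms by (simp add: conj_coaction_def lin_ext_bas tensor_bas)

lemma sum_left_translate:
  fixes F :: "'a \<Rightarrow> 'v::comm_monoid_add"
  assumes "finite (carrier G)" "k \<in> carrier G"
  shows "(\<Sum>f\<in>carrier G. F f) = (\<Sum>m\<in>carrier G. F (k \<otimes> m))"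
proof (rule sum.reindex_bij_witness[of _ "\<lambda>m. k \<otimes> m" "\<lambda>f. inv k \<otimes> f"])
  fix a assume "a \<in> carrier G"
  then show "k \<otimes> (inv k \<otimes> a) = a" "inv k \<otimes> (k \<otimes> a) = a"
    using assms by (simp_all add: m_assoc[symmetric])
qed (use assms in \<open>auto simp: m_assoc[symmetric]\<close>)

lemma cancel_mid:
  assumes "x \<in> carrier G" "y \<in> carrier G"
  shows "x \<otimes> (inv x \<otimes> y) = y" "inv x \<otimes> (x \<otimes> y) = y"
  using assms by (simp_all add: m_assoc[symmetric])

lemma sum_delta_one:
  assumes "finite (carrier G)" "a \<in> carrier G"
  shows "(\<Sum>f\<in>carrier G. cscale (if f = a then 1 else 0) (F f)) = F a"
proof -
  have "(\<Sum>f\<in>carrier G. cscale (if f = a then 1 else 0) (F f)) =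
     (\<Sum>f\<in>carrier G. if f = a then F f else 0)"
    by (rule sum.cong) auto
  then show ?thesis using assms by simp
qed

lemma coalgebra_D_dual:
  assumes fin: "finite (carrier G)"
  shows "coalgebra (D_dual G)"
proof -
  let ?B = "carrier G \<times> carrier G" and ?D = "comult (D_dual G)" and ?e = "counit (D_dual G)"
  have finB: "finite ?B" using fin by simp
  have l1: "linear_map cscale (cspan ?B) cscale (cspan (?B \<times> ?B)) ?D"
  proof -
    have "(\<Sum>f\<in>carrier G. bas ((f, inv f \<otimes> g \<otimes> h \<otimes> inv g \<otimes> f), (inv f \<otimes> g, h)))
       \<in> cspan (?B \<times> ?B)" if "g \<in> carrier G" "h \<in> carrier G" for g h
      unfolding cspan_def by (intro cfun.span_sum cfun.span_base imageI) (use that in auto)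
    then show ?thesis
      unfolding D_dual_def by (auto intro!: linear_map_lin_ext finB simp: tensor_bas)
  qed
  have l2: "linear_map cscale (cspan ?B) (*) UNIV ?e"
    by (auto simp: linear_map_def D_dual_def cscale_def sum.distrib[symmetric] sum_distrib_left
        intro!: sum.cong)
  have coassoc: "tensor_assoc (tensor_map ?B ?B ?D id (?D v)) = tensor_map ?B ?B id ?D (?D v)"
    if "v \<in> cspan ?B" for v
  proof (rule lin_eqI[OF _ _ _ that])
    fix b assume "b \<in> ?B"
    then obtain g h where b: "b = (g, h)" and g: "g \<in> carrier G" and h: "h \<in> carrier G" by auto
    have "tensor_assoc (tensor_map ?B ?B ?D id (?D (bas b))) =
      (\<Sum>f\<in>carrier G. \<Sum>k\<in>carrier G. bas ((k, inv k \<otimes> f \<otimes> (inv f \<otimes> g \<otimes> h \<otimes> inv g \<otimes> f) \<otimes> inv f \<otimes> k),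
         (inv k \<otimes> f, inv f \<otimes> g \<otimes> h \<otimes> inv g \<otimes> f), (inv f \<otimes> g, h)))"
      using g h fin unfolding b
      by (simp add: comult_D_dual_bas tensor_map_sum tensor_map_bas tensor_sum_left tensor_bas
          tensor_assoc_sum tensor_assoc_bas)
    also have "\<dots> = (\<Sum>k\<in>carrier G. \<Sum>f\<in>carrier G.
         bas ((k, inv k \<otimes> f \<otimes> (inv f \<otimes> g \<otimes> h \<otimes> inv g \<otimes> f) \<otimes> inv f \<otimes> k),
         (inv k \<otimes> f, inv f \<otimes> g \<otimes> h \<otimes> inv g \<otimes> f), (inv f \<otimes> g, h)))"
      by (rule sum.swap)
    also have "\<dots> = (\<Sum>k\<in>carrier G. \<Sum>m\<in>carrier G.
         bas ((k, inv k \<otimes> g \<otimes> h \<otimes> inv g \<otimes> k),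
         (m, inv m \<otimes> (inv k \<otimes> g) \<otimes> h \<otimes> inv (inv k \<otimes> g) \<otimes> m), (inv m \<otimes> (inv k \<otimes> g), h)))"
    proof (rule sum.cong[OF refl])
      fix k assume k: "k \<in> carrier G"
      show "(\<Sum>f\<in>carrier G.
         bas ((k, inv k \<otimes> f \<otimes> (inv f \<otimes> g \<otimes> h \<otimes> inv g \<otimes> f) \<otimes> inv f \<otimes> k),
         (inv k \<otimes> f, inv f \<otimes> g \<otimes> h \<otimes> inv g \<otimes> f), (inv f \<otimes> g, h))) =
        (\<Sum>m\<in>carrier G.
         bas ((k, inv k \<otimes> g \<otimes> h \<otimes> inv g \<otimes> k),
         (m, inv m \<otimes> (inv k \<otimes> g) \<otimes> h \<otimes> inv (inv k \<otimes> g) \<otimes> m), (inv m \<otimes> (inv k \<otimes> g), h)))"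
        using k g h
        by (subst sum_left_translate[OF fin k])
          (auto intro!: sum.cong arg_cong[where f = bas] simp: m_assoc inv_mult_group cancel_mid)
    qed
    also have "\<dots> = tensor_map ?B ?B id ?D (?D (bas b))"
      using g h fin unfolding b
      by (simp add: comult_D_dual_bas tensor_map_sum tensor_map_bas tensor_sum_right tensor_bas)
    finally show "tensor_assoc (tensor_map ?B ?B ?D id (?D (bas b))) =
      tensor_map ?B ?B id ?D (?D (bas b))" .
  qed (rule lin_comp[OF lin_tensor_assoc lin_comp[OF lin_tensor_map D_dual_simps(2)]]
      lin_comp[OF lin_tensor_map D_dual_simps(2)])+
  have counit_l: "form_tensor_id ?B ?B ?e (?D v) = v" if "v \<in> cspan ?B" for v
  proof (rule lin_eqI[OF _ _ _ that])
    fix b assume "b \<in> ?B"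
    then obtain g h where b: "b = (g, h)" and g: "g \<in> carrier G" and h: "h \<in> carrier G" by auto
    show "form_tensor_id ?B ?B ?e (?D (bas b)) = bas b"
      using g h fin unfolding b
      by (simp add: comult_D_dual_bas form_tensor_id_sum form_tensor_id_bas counit_D_dual_bas
          sum_delta_one)
  qed (rule lin_comp[OF lin_form_tensor_id D_dual_simps(2)] lin_id)+
  have counit_r: "id_tensor_form ?B ?B ?e (?D v) = v" if "v \<in> cspan ?B" for v
  proof (rule lin_eqI[OF _ _ _ that])
    fix b assume "b \<in> ?B"
    then obtain g h where b: "b = (g, h)" and g: "g \<in> carrier G" and h: "h \<in> carrier G" by auto
    have eq: "inv f \<otimes> g = \<one> \<longleftrightarrow> f = g" if "f \<in> carrier G" for f
      using that g by (metis inv_closed inv_equality inv_inv l_inv)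
    have "id_tensor_form ?B ?B ?e (?D (bas b)) =
      (\<Sum>f\<in>carrier G. cscale (if f = g then 1 else 0) (bas (f, inv f \<otimes> g \<otimes> h \<otimes> inv g \<otimes> f)))"
      using g h fin unfolding b
      by (auto simp: comult_D_dual_bas id_tensor_form_sum id_tensor_form_bas counit_D_dual_bas eq
          intro!: sum.cong)
    also have "\<dots> = bas b"
      using g h fin by (simp add: sum_delta_one b m_assoc cancel_mid)
    finally show "id_tensor_form ?B ?B ?e (?D (bas b)) = bas b" .
  qed (rule lin_comp[OF lin_id_tensor_form D_dual_simps(2)] lin_id)+
  show ?thesis
    unfolding coalgebra_def D_dual_simps
    using finB l1 l2 coassoc counit_l counit_r by blast
qed

lemma left_comodule_conj_coaction:
  assumes fin: "finite (carrier G)"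
  shows "left_comodule (D_dual G) (carrier G) (conj_coaction G)"
proof -
  let ?M = "carrier G" and ?\<beta> = "conj_coaction G"
  let ?B = "carrier G \<times> carrier G" and ?D = "comult (D_dual G)" and ?e = "counit (D_dual G)"
  have lin\<beta>: "lin ?\<beta>" by (simp add: conj_coaction_def lin_lin_ext)
  have l: "linear_map cscale (cspan ?M) cscale (cspan (?B \<times> ?M)) ?\<beta>"
  proof -
    have "(\<Sum>f\<in>carrier G. bas ((f, inv f \<otimes> g \<otimes> f), inv f \<otimes> g \<otimes> f)) \<in> cspan (?B \<times> ?M)"
      if "g \<in> carrier G" for g
      unfolding cspan_def by (intro cfun.span_sum cfun.span_base imageI) (use that in auto)
    then show ?thesis
      unfolding conj_coaction_def by (auto intro!: linear_map_lin_ext fin simp: tensor_bas)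
  qed
  have coassoc: "tensor_assoc (tensor_map ?B ?M ?D id (?\<beta> v)) = tensor_map ?B ?M id ?\<beta> (?\<beta> v)"
    if "v \<in> cspan ?M" for v
  proof (rule lin_eqI[OF _ _ _ that])
    fix g assume g: "g \<in> ?M"
    have "tensor_assoc (tensor_map ?B ?M ?D id (?\<beta> (bas g))) =
      (\<Sum>f\<in>carrier G. \<Sum>k\<in>carrier G. bas ((k, inv k \<otimes> f \<otimes> (inv f \<otimes> g \<otimes> f) \<otimes> inv f \<otimes> k),
         (inv k \<otimes> f, inv f \<otimes> g \<otimes> f), inv f \<otimes> g \<otimes> f))"
      using g fin
      by (simp add: comult_D_dual_bas conj_coaction_bas tensor_map_sum tensor_map_bas
          tensor_sum_left tensor_bas tensor_assoc_sum tensor_assoc_bas)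
    also have "\<dots> = (\<Sum>k\<in>carrier G. \<Sum>f\<in>carrier G.
         bas ((k, inv k \<otimes> f \<otimes> (inv f \<otimes> g \<otimes> f) \<otimes> inv f \<otimes> k),
         (inv k \<otimes> f, inv f \<otimes> g \<otimes> f), inv f \<otimes> g \<otimes> f))"
      by (rule sum.swap)
    also have "\<dots> = (\<Sum>k\<in>carrier G. \<Sum>m\<in>carrier G.
         bas ((k, inv k \<otimes> g \<otimes> k),
         (m, inv m \<otimes> (inv k \<otimes> g \<otimes> k) \<otimes> m), inv m \<otimes> (inv k \<otimes> g \<otimes> k) \<otimes> m))"
    proof (rule sum.cong[OF refl])
      fix k assume k: "k \<in> carrier G"
      show "(\<Sum>f\<in>carrier G.
         bas ((k, inv k \<otimes> f \<otimes> (inv f \<otimes> g \<otimes> f) \<otimes> inv f \<otimes> k),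
         (inv k \<otimes> f, inv f \<otimes> g \<otimes> f), inv f \<otimes> g \<otimes> f)) =
        (\<Sum>m\<in>carrier G.
         bas ((k, inv k \<otimes> g \<otimes> k),
         (m, inv m \<otimes> (inv k \<otimes> g \<otimes> k) \<otimes> m), inv m \<otimes> (inv k \<otimes> g \<otimes> k) \<otimes> m))"
        using k g
        by (subst sum_left_translate[OF fin k])
          (auto intro!: sum.cong arg_cong[where f = bas] simp: m_assoc inv_mult_group cancel_mid)
    qed
    also have "\<dots> = tensor_map ?B ?M id ?\<beta> (?\<beta> (bas g))"
      using g fin
      by (simp add: conj_coaction_bas tensor_map_sum tensor_map_bas tensor_sum_right tensor_bas)
    finally show "tensor_assoc (tensor_map ?B ?M ?D id (?\<beta> (bas g))) =
      tensor_map ?B ?M id ?\<beta> (?\<beta> (bas g))" .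
  qed (rule lin_comp[OF lin_tensor_assoc lin_comp[OF lin_tensor_map lin\<beta>]]
      lin_comp[OF lin_tensor_map lin\<beta>])+
  have counit: "form_tensor_id ?B ?M ?e (?\<beta> v) = v" if "v \<in> cspan ?M" for v
  proof (rule lin_eqI[OF _ _ _ that])
    fix g assume g: "g \<in> ?M"
    show "form_tensor_id ?B ?M ?e (?\<beta> (bas g)) = bas g"
      using g fin
      by (simp add: conj_coaction_bas form_tensor_id_sum form_tensor_id_bas counit_D_dual_bas
          sum_delta_one)
  qed (rule lin_comp[OF lin_form_tensor_id lin\<beta>] lin_id)+
  show ?thesis
    unfolding left_comodule_def D_dual_simps
    using coalgebra_D_dual[OF fin] fin l coassoc counit by blast
qed

end

end

theory Submission
  imports Defs "HOL-Library.Disjoint_Sets"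
begin

text \<open>
  Comparing the coefficients of \<open>\<delta>\<^sub>f \<otimes> x \<otimes> y\<close> on both sides of the comodule map condition at \<open>v\<close>
  gives \<open>v (f x f\<inverse>) (L x) y = (L v) (f x f\<inverse>)\<close> if \<open>x = y\<close>, and \<open>v (f x f\<inverse>) (L x) y = 0\<close> otherwise.
  Testing this on group elements shows that \<open>L\<close> is a comodule map iff it is diagonal in
  the basis \<open>G\<close> with entries constant on conjugacy classes. The eigenspaces of such a map are
  spanned by unions of classes; conversely, if the eigenspaces are spanned by unions of classes and
  together span everything, then every class lies in a single eigenspace.
\<close>

section \<open>Coordinates of linear maps and of direct sums\<close>

text \<open>\<open>linear_map\<close> constrains \<open>L\<close> only on \<open>cspan B\<close>, so
  the induction over subsets \<open>A\<close> of \<open>B\<close> checks that each partial sum stays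
  in \<open>cspan B\<close> before additivity is applied.\<close>

lemma linear_map_apply_coords:
  assumes L: "linear_map cscale (cspan B) cscale (cspan D) L"
    and B: "finite B" and v: "v \<in> cspan B"
  shows "L v x = (\<Sum>b\<in>B. v b * L (bas b) x)"
proof -
  have z: "0 \<in> cspan B" unfolding cspan_def by (rule cfun.span_zero)
  have L0: "L 0 = 0"
  proof -
    have "L (cscale 0 0) = cscale 0 (L 0)"
      using L z unfolding linear_map_def by blast
    then show ?thesis by simp
  qed
  have "L (\<Sum>b\<in>A. cscale (v b) (bas b)) = (\<Sum>b\<in>A. cscale (v b) (L (bas b)))"
    if "A \<subseteq> B" for A
    using finite_subset[OF that B] that
  proof (induction A rule: finite_induct)
    case empty
    show ?case by (simp only: sum.empty L0)
  next
    case (insert a A)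
    have 1: "bas a \<in> cspan B" using insert.prems by (simp add: bas_in_cspan)
    then have 2: "cscale (v a) (bas a) \<in> cspan B"
      unfolding cspan_def by (rule cfun.span_scale)
    have 3: "(\<Sum>b\<in>A. cscale (v b) (bas b)) \<in> cspan B"
      unfolding cspan_def using insert.prems
      by (intro cfun.span_sum cfun.span_scale cfun.span_base) auto
    have "L (\<Sum>b\<in>insert a A. cscale (v b) (bas b)) =
        L (cscale (v a) (bas a) + (\<Sum>b\<in>A. cscale (v b) (bas b)))"
      using insert.hyps by simp
    also have "\<dots> = L (cscale (v a) (bas a)) + L (\<Sum>b\<in>A. cscale (v b) (bas b))"
      using L 2 3 unfolding linear_map_def by blast
    also have "L (cscale (v a) (bas a)) = cscale (v a) (L (bas a))"
      using L 1 unfolding linear_map_def by blast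
    finally show ?case using insert by simp
  qed
  moreover have "v = (\<Sum>b\<in>B. cscale (v b) (bas b))"
    using v cspan_iff[OF B] by (intro expand_bas[OF B]) blast
  ultimately have "L v = (\<Sum>b\<in>B. cscale (v b) (L (bas b)))" by (metis order_refl)
  then show ?thesis by (simp add: sum_fun_app cscale_def)
qed

text \<open>Meant as a congruence rule: it supplies the family with an index, so that equations for
  \<open>V i\<close> can rewrite a family given as a partial application such as
  \<open>eigenspace V L\<close>.\<close>

lemma is_direct_sum_cong:
  assumes "I = J" "\<And>i. i \<in> J \<Longrightarrow> V i = W i" "E = F"
  shows "is_direct_sum I V E \<longleftrightarrow> is_direct_sum J W F"
proof -
  have "(\<forall>i\<in>J. w i \<in> V i) \<longleftrightarrow> (\<forall>i\<in>J. w i \<in> W i)" for w using assms(2) by auto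
  then show ?thesis using assms by (simp add: is_direct_sum_def)
qed

text \<open>The components have disjoint supports. A vector is split by cutting it off outside each
  \<open>B i\<close>, and a component can be read off from the sum on its own support, which gives
  uniqueness.\<close>

lemma is_direct_sum_cspan:
  assumes I: "finite I" and fin: "\<And>i. i \<in> I \<Longrightarrow> finite (B i)"
    and disj: "disjoint_family_on B I"
  shows "is_direct_sum I (\<lambda>i. cspan (B i)) (cspan (\<Union>i\<in>I. B i))"
  unfolding is_direct_sum_def
proof (intro conjI allI impI ballI)
  have at: "(\<Sum>i\<in>I. w i) x = w j x"
    if "\<forall>i\<in>I. w i \<in> cspan (B i)" "j \<in> I" "x \<in> B j" for w j x
  proof -
    have "w i x = 0" if "i \<in> I - {j}" for i
    proof -
      have "x \<notin> B i"
        using that \<open>j \<in> I\<close> \<open>x \<in> B j\<close> disj unfolding disjoint_family_on_def by blast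
      then show ?thesis using that \<open>\<forall>i\<in>I. w i \<in> cspan (B i)\<close> by (simp add: cspan_iff fin)
    qed
    then show ?thesis
      by (simp add: sum_fun_app sum.remove[OF I \<open>j \<in> I\<close>])
  qed
  show "cspan (\<Union>i\<in>I. B i) = {\<Sum>i\<in>I. w i |w. \<forall>i\<in>I. w i \<in> cspan (B i)}"
  proof (intro equalityI subsetI)
    fix v assume v: "v \<in> cspan (\<Union>i\<in>I. B i)"
    define w where "w i = (\<lambda>x. if x \<in> B i then v x else 0)" for i
    have w: "\<forall>i\<in>I. w i \<in> cspan (B i)" by (auto simp: cspan_iff fin w_def)
    have "v x = (\<Sum>i\<in>I. w i) x" for x
    proof (cases "x \<in> (\<Union>i\<in>I. B i)")
      case True
      then obtain j where "j \<in> I" "x \<in> B j" by auto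
      then show ?thesis using at[OF w] by (simp add: w_def)
    next
      case False
      then show ?thesis using v I fin by (simp add: cspan_iff sum_fun_app w_def)
    qed
    then have "v = (\<Sum>i\<in>I. w i)" by blast
    then show "v \<in> {\<Sum>i\<in>I. w i |w. \<forall>i\<in>I. w i \<in> cspan (B i)}" using w by blast
  next
    fix v assume "v \<in> {\<Sum>i\<in>I. w i |w. \<forall>i\<in>I. w i \<in> cspan (B i)}"
    then show "v \<in> cspan (\<Union>i\<in>I. B i)"
      using I fin by (auto simp: cspan_iff sum_fun_app intro!: sum.neutral)
  qed
  fix w i assume w: "(\<forall>i\<in>I. w i \<in> cspan (B i)) \<and> (\<Sum>i\<in>I. w i) = 0" and i: "i \<in> I"
  show "w i = 0"
  proof
    fix x
    show "w i x = 0 x"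
    proof (cases "x \<in> B i")
      case True
      then show ?thesis using at[of w i x] w i by simp
    next
      case False
      then show ?thesis using w i by (simp add: cspan_iff fin)
    qed
  qed
qed (simp_all add: I cspan_def cfun.subspace_span)

lemma is_direct_sum_memE:
  assumes "is_direct_sum I V E" "v \<in> E"
  obtains w where "\<forall>i\<in>I. w i \<in> V i" "v = (\<Sum>i\<in>I. w i)"
proof -
  have "E = {\<Sum>i\<in>I. w i | w. \<forall>i\<in>I. w i \<in> V i}"
    using assms(1) unfolding is_direct_sum_def by (elim conjE)
  then have "v \<in> {\<Sum>i\<in>I. w i | w. \<forall>i\<in>I. w i \<in> V i}" using assms(2) by (rule subst)
  then show thesis using that by blast
qed

text \<open>Place the vector in slot \<open>i\<close> and 0 in all others; 0 is admissible there
  because every \<open>V j\<close> is a subspace.\<close>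

lemma is_direct_sum_component_subset:
  assumes "is_direct_sum I V E" "i \<in> I"
  shows "V i \<subseteq> E"
proof
  fix v assume v: "v \<in> V i"
  have fin: "finite I" and sub: "\<forall>i\<in>I. cfun.subspace (V i)"
    and E: "E = {\<Sum>i\<in>I. w i | w. \<forall>i\<in>I. w i \<in> V i}"
    using assms(1) unfolding is_direct_sum_def by - (elim conjE, assumption)+
  let ?w = "\<lambda>j. if j = i then v else 0"
  have "\<forall>j\<in>I. ?w j \<in> V j"
    using v sub by (simp add: cfun.subspace_0)
  moreover have "v = (\<Sum>j\<in>I. ?w j)"
    by (simp only: sum.delta[OF fin] assms(2) if_True)
  ultimately show "v \<in> E" unfolding E by (intro CollectI exI[of _ ?w] conjI)
qed

text \<open>If every summand vanished at \<open>x\<close>, so would the sum. This locates first an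
  eigenspace and then a conjugacy class that involves a given group element.\<close>

lemma is_direct_sum_nonzero_coordE:
  assumes "is_direct_sum I V E" "v \<in> E" "v x \<noteq> 0"
  obtains i w where "i \<in> I" "w \<in> V i" "w x \<noteq> 0"
proof -
  obtain w where w: "\<forall>i\<in>I. w i \<in> V i" "v = (\<Sum>i\<in>I. w i)"
    using is_direct_sum_memE[OF assms(1,2)] .
  then have "(\<Sum>i\<in>I. w i x) \<noteq> 0" using assms(3) by (simp add: sum_fun_app)
  then obtain i where "i \<in> I" "w i x \<noteq> 0" by (rule sum.not_neutral_contains_not_neutral)
  then show thesis using that w(1) by blast
qed

section \<open>Coordinates of the coaction and of the comodule map condition\<close>

lemma tensor_map_id_apply:
  assumes B: "finite B" and M: "finite M"
  shows "tensor_map B M id L w (b, y) = (if b \<in> B then \<Sum>m\<in>M. w (b, m) * L (bas m) y else 0)"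
proof -
  have "tensor_map B M id L w (b, y) =
      (\<Sum>p\<in>B. \<Sum>m\<in>M. w (p, m) * ((if b = p then 1 else 0) * L (bas m) y))"
    unfolding sum.cartesian_product
    by (simp add: tensor_map_def lin_ext_def sum_fun_app cscale_def tensor_def bas_def
        split_def)
  also have "\<dots> = (\<Sum>p\<in>B. if b = p then \<Sum>m\<in>M. w (p, m) * L (bas m) y else 0)"
    by (intro sum.cong) auto
  finally show ?thesis using B by simp
qed

context group
begin

lemma conj_eq_iff:
  assumes "f \<in> carrier G" "g \<in> carrier G" "x \<in> carrier G"
  shows "inv f \<otimes> g \<otimes> f = x \<longleftrightarrow> g = f \<otimes> x \<otimes> inv f"
  using assms by (metis inv_closed inv_solve_left inv_solve_right m_assoc m_closed)

text \<open>The basis element g contributes to this coefficient only through the summand indexed by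
  \<open>f\<close>, and only if conjugating g back by \<open>f\<close> gives both \<open>x\<close>
  and \<open>y\<close>; this leaves the single element
  \<open>f \<otimes> x \<otimes> inv f\<close>.\<close>

lemma conj_coaction_apply:
  assumes fin: "finite (carrier G)" and f: "f \<in> carrier G" and x: "x \<in> carrier G"
  shows "conj_coaction G v ((f, x), y) = (if y = x then v (f \<otimes> x \<otimes> inv f) else 0)"
proof -
  have "conj_coaction G v ((f, x), y) = (\<Sum>g\<in>carrier G. \<Sum>k\<in>carrier G.
      if f = k then (if x = inv k \<otimes> g \<otimes> k \<and> y = inv k \<otimes> g \<otimes> k then v g else 0) else 0)"
    unfolding conj_coaction_def lin_ext_def tensor_bas
    by (auto simp: sum_fun_app cscale_def bas_def sum_distrib_left intro!: sum.cong)
  also have "\<dots> = (\<Sum>g\<in>carrier G. if x = inv f \<otimes> g \<otimes> f \<and> y = inv f \<otimes> g \<otimes> f then v g else 0)"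
    using fin f by simp
  also have "\<dots> = (\<Sum>g\<in>carrier G. if g = f \<otimes> x \<otimes> inv f then (if y = x then v g else 0) else 0)"
  proof (rule sum.cong[OF refl])
    fix g assume g: "g \<in> carrier G"
    show "(if x = inv f \<otimes> g \<otimes> f \<and> y = inv f \<otimes> g \<otimes> f then v g else 0) =
        (if g = f \<otimes> x \<otimes> inv f then (if y = x then v g else 0) else 0)"
      using conj_eq_iff[OF f g x] by auto
  qed
  finally show ?thesis using fin f x by simp
qed

text \<open>Here \<open>l\<close> is the family of diagonal entries of \<open>L\<close>.
  Coefficients at f = 1 yield diagonality; those at general f link the entries at conjugate
  elements.\<close>

lemma left_comodule_map_conj_coaction_iff:
  assumes fin: "finite (carrier G)"
    and L: "linear_map cscale (cspan (carrier G)) cscale (cspan (carrier G)) L"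
  shows "left_comodule_map (D_dual G) (carrier G) (conj_coaction G) (carrier G) (conj_coaction G) L
    \<longleftrightarrow> (\<exists>l. (\<forall>g\<in>carrier G. L (bas g) = cscale (l g) (bas g)) \<and>
      (\<forall>f\<in>carrier G. \<forall>g\<in>carrier G. l (f \<otimes> g \<otimes> inv f) = l g))"
    (is "?comod \<longleftrightarrow> (\<exists>l. ?diag l)")
proof -
  let ?B = "carrier G \<times> carrier G"
  have finB: "finite ?B" using fin by simp
  \<comment> \<open>The coaction is supported where its last two indices agree, so only m = x
    survives in the sum over the module basis.\<close>
  have lhs: "tensor_map ?B (carrier G) id L (conj_coaction G v) ((f, x), y) =
      v (f \<otimes> x \<otimes> inv f) * L (bas x) y" if "f \<in> carrier G" "x \<in> carrier G" for v f x y
  proof -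
    have "tensor_map ?B (carrier G) id L (conj_coaction G v) ((f, x), y) =
        (\<Sum>m\<in>carrier G. if m = x then v (f \<otimes> x \<otimes> inv f) * L (bas x) y else 0)"
      unfolding tensor_map_id_apply[OF finB fin]
      using that by (simp only: conj_coaction_apply[OF fin that] mem_Times_iff fst_conv snd_conv
          simp_thms if_True) (rule sum.cong, auto)
    then show ?thesis using that fin by simp
  qed
  \<comment> \<open>Equality of tensors is equality of functions on the whole type, so indices
    outside the basis must be compared too; both sides are 0 there.\<close>
  have outside: "conj_coaction G v (p, y) = 0" if "v \<in> cspan (carrier G)" "p \<notin> ?B" for v p y
  proof -
    have "conj_coaction G v \<in> cspan (?B \<times> carrier G)"
      using left_comodule_conj_coaction[OF fin] that(1)
      by (auto simp: left_comodule_def linear_map_def D_dual_simps)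
    then show ?thesis using that(2) finB fin by (cases p) (auto simp: cspan_iff)
  qed
  have L_span: "L v \<in> cspan (carrier G)" if "v \<in> cspan (carrier G)" for v
    using L that by (auto simp: linear_map_def)
  \<comment> \<open>The comodule axioms and the linearity of \<open>L\<close> are already available;
    only the intertwining identity has to be put into coordinates.\<close>
  have iff: "?comod \<longleftrightarrow> (\<forall>v\<in>cspan (carrier G). \<forall>f\<in>carrier G. \<forall>x\<in>carrier G. \<forall>y.
      v (f \<otimes> x \<otimes> inv f) * L (bas x) y = (if y = x then L v (f \<otimes> x \<otimes> inv f) else 0))"
    (is "_ \<longleftrightarrow> ?coords")
  proof -
    have "tensor_map ?B (carrier G) id L (conj_coaction G v) = conj_coaction G (L v) \<longleftrightarrow>
        (\<forall>f\<in>carrier G. \<forall>x\<in>carrier G. \<forall>y.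
          v (f \<otimes> x \<otimes> inv f) * L (bas x) y = (if y = x then L v (f \<otimes> x \<otimes> inv f) else 0))"
      (is "?l = ?r \<longleftrightarrow> ?c") if v: "v \<in> cspan (carrier G)" for v
    proof
      assume eq: "?l = ?r"
      show ?c
      proof (intro ballI allI)
        fix f x y assume fx: "f \<in> carrier G" "x \<in> carrier G"
        show "v (f \<otimes> x \<otimes> inv f) * L (bas x) y = (if y = x then L v (f \<otimes> x \<otimes> inv f) else 0)"
          unfolding lhs[OF fx, symmetric] conj_coaction_apply[OF fin fx, symmetric] eq ..
      qed
    next
      assume c: ?c
      have "?l (p, y) = ?r (p, y)" for p y
      proof (cases "p \<in> ?B")
        case True
        then obtain f x where p: "p = (f, x)" and fx: "f \<in> carrier G" "x \<in> carrier G" by blast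
        show ?thesis
          unfolding p lhs[OF fx] conj_coaction_apply[OF fin fx] using c fx by blast
      next
        case False
        then show ?thesis
          using outside[OF L_span[OF v]] by (simp add: tensor_map_id_apply[OF finB fin])
      qed
      then show "?l = ?r" by (auto simp: fun_eq_iff)
    qed
    then show ?thesis
      unfolding left_comodule_map_def D_dual_simps
      using left_comodule_conj_coaction[OF fin] L by simp
  qed
  show ?thesis
    unfolding iff
  proof
    assume c: ?coords
    \<comment> \<open>Test vector \<open>bas g\<close> with f = 1 and x = g: its coefficient is 1,
      so \<open>L (bas g)\<close> vanishes at every y other than g.\<close>
    have diag: "L (bas g) = cscale (L (bas g) g) (bas g)" if g: "g \<in> carrier G" for g
    proof
      fix y
      have "bas g (\<one> \<otimes> g \<otimes> inv \<one>) * L (bas g) y =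
          (if y = g then L (bas g) (\<one> \<otimes> g \<otimes> inv \<one>) else 0)"
        using c g bas_in_cspan[OF g] one_closed by blast
      then show "L (bas g) y = cscale (L (bas g) g) (bas g) y"
        using g by (auto simp: cscale_def bas_def)
    qed
    \<comment> \<open>Test vector \<open>bas (f \<otimes> g \<otimes> inv f)\<close> with x = y = g:
      its coefficient is again 1, which equates the two diagonal entries.\<close>
    have const: "L (bas (f \<otimes> g \<otimes> inv f)) (f \<otimes> g \<otimes> inv f) = L (bas g) g"
      if "f \<in> carrier G" "g \<in> carrier G" for f g
    proof -
      have "f \<otimes> g \<otimes> inv f \<in> carrier G" using that by simp
      from bas_in_cspan[OF this]
      have "bas (f \<otimes> g \<otimes> inv f) (f \<otimes> g \<otimes> inv f) * L (bas g) g =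
          (if g = g then L (bas (f \<otimes> g \<otimes> inv f)) (f \<otimes> g \<otimes> inv f) else 0)"
        using c that by blast
      then show ?thesis by (simp add: bas_def)
    qed
    show "\<exists>l. ?diag l"
      using diag const by (intro exI[of _ "\<lambda>g. L (bas g) g"]) auto
  next
    assume "\<exists>l. ?diag l"
    then obtain l where l: "?diag l" by blast
    show ?coords
    proof (intro ballI allI)
      fix v f x y assume v: "v \<in> cspan (carrier G)" and f: "f \<in> carrier G" and x: "x \<in> carrier G"
      have Lb: "L (bas b) z = (if b = z then l z else 0)" if "b \<in> carrier G" for b z
        unfolding bspec[OF conjunct1[OF l] that] by (simp add: cscale_def bas_def)
      \<comment> \<open>Since \<open>L\<close> multiplies the coordinate at z by \<open>l z\<close>,
        the identity for y = x reduces to equality of \<open>l\<close> at x and at its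
        conjugate.\<close>
      have "L v z = l z * v z" if "z \<in> carrier G" for z
      proof -
        have "L v z = (\<Sum>b\<in>carrier G. if b = z then l z * v z else 0)"
          unfolding linear_map_apply_coords[OF L fin v]
          by (intro sum.cong) (auto simp: Lb)
        then show ?thesis using that fin by simp
      qed
      then show "v (f \<otimes> x \<otimes> inv f) * L (bas x) y = (if y = x then L v (f \<otimes> x \<otimes> inv f) else 0)"
        using f x conjunct2[OF l] by (simp add: Lb)
    qed
  qed
qed

section \<open>Conjugacy classes partition the group\<close>

lemma conj_classes_eq:
  "conj_classes G = (\<lambda>g. (\<lambda>f. f \<otimes> g \<otimes> inv f) ` carrier G) ` carrier G"
  unfolding conj_classes_def orbits_def orbit_def by blast

lemma conj_class_subset_carrier: "C \<in> conj_classes G \<Longrightarrow> C \<subseteq> carrier G"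
  by (auto simp: conj_classes_eq)

lemma conj_class_closed:
  assumes "C \<in> conj_classes G" "g \<in> C" "f \<in> carrier G"
  shows "f \<otimes> g \<otimes> inv f \<in> C"
proof -
  obtain a k where a: "a \<in> carrier G" "C = (\<lambda>f. f \<otimes> a \<otimes> inv f) ` carrier G"
    and k: "k \<in> carrier G" "g = k \<otimes> a \<otimes> inv k"
    using assms by (auto simp: conj_classes_eq)
  have "f \<otimes> g \<otimes> inv f = (f \<otimes> k) \<otimes> a \<otimes> inv (f \<otimes> k)"
    using a k assms(3) by (simp add: m_assoc inv_mult_group)
  then show ?thesis using a k assms(3) by blast
qed

text \<open>Conjugate \<open>g\<close> back to the representative a and then forward to
  \<open>h\<close>; the conjugator is \<open>k \<otimes> inv j\<close>.\<close>

lemma conj_classE: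
  assumes "C \<in> conj_classes G" "g \<in> C" "h \<in> C"
  obtains f where "f \<in> carrier G" "h = f \<otimes> g \<otimes> inv f"
proof -
  obtain a j k where a: "a \<in> carrier G" and jk: "j \<in> carrier G" "k \<in> carrier G"
    and g: "g = j \<otimes> a \<otimes> inv j" and h: "h = k \<otimes> a \<otimes> inv k"
    using assms by (auto simp: conj_classes_eq)
  have "h = (k \<otimes> inv j) \<otimes> g \<otimes> inv (k \<otimes> inv j)"
    using a jk by (simp add: g h m_assoc inv_mult_group cancel_mid)
  then show thesis using that[of "k \<otimes> inv j"] jk by simp
qed

lemma disjoint_conj_classes: "disjoint (conj_classes G)"
proof (rule disjointI)
  fix C D assume CD: "C \<in> conj_classes G" "D \<in> conj_classes G" "C \<noteq> D"
  \<comment> \<open>Every element of A is a conjugate of the common element g, and B is closed under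
    conjugation; exchanging A and B gives equality.\<close>
  have "A \<subseteq> B" if "A \<in> conj_classes G" "B \<in> conj_classes G" "g \<in> A" "g \<in> B" for A B g
    using that conj_class_closed conj_classE by (metis subsetI)
  then show "C \<inter> D = {}" using CD by blast
qed

lemma Union_conj_classes: "\<Union>(conj_classes G) = carrier G"
proof
  show "carrier G \<subseteq> \<Union>(conj_classes G)"
  proof
    fix g assume g: "g \<in> carrier G"
    then have "g = \<one> \<otimes> g \<otimes> inv \<one>" by simp
    then show "g \<in> \<Union>(conj_classes G)" using g unfolding conj_classes_eq by blast
  qed
qed (use conj_class_subset_carrier in blast)

lemma finite_conj_classes: "finite (carrier G) \<Longrightarrow> finite (conj_classes G)"
  by (simp add: conj_classes_eq)

end

section \<open>Eigenspaces and eigenvalues of diagonal maps\<close>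

text \<open>In coordinates the eigenvector equation reads \<open>l x * v x = c * v x\<close>, so
  \<open>v\<close> must vanish wherever \<open>l x\<close> differs from \<open>c\<close>. If no
  entry equals \<open>c\<close>, both sides are the zero space.\<close>

lemma diagonal_eigenspace:
  assumes B: "finite B" and L: "linear_map cscale (cspan B) cscale (cspan B) L"
    and diag: "\<And>b. b \<in> B \<Longrightarrow> L (bas b) = cscale (l b) (bas b)"
  shows "eigenspace (cspan B) L c = cspan {b \<in> B. l b = c}"
proof -
  have Lv: "L v x = (if x \<in> B then l x * v x else 0)" if "v \<in> cspan B" for v x
  proof -
    have "L (bas b) x = (if b = x then l x else 0)" if "b \<in> B" for b
      unfolding diag[OF that] by (simp add: cscale_def bas_def)
    then have "L v x = (\<Sum>b\<in>B. if b = x then l x * v x else 0)"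
      unfolding linear_map_apply_coords[OF L B that]
      by (intro sum.cong) auto
    then show ?thesis using B by simp
  qed
  show ?thesis
  proof (intro Set.set_eqI iffI)
    fix v assume "v \<in> eigenspace (cspan B) L c"
    then have v: "v \<in> cspan B" "L v = cscale c v" by (auto simp: eigenspace_def)
    have "v x = 0" if "\<not> (x \<in> B \<and> l x = c)" for x
    proof (cases "x \<in> B")
      case True
      have "l x * v x = c * v x"
        using Lv[OF v(1), of x] v(2) True by (auto simp: cscale_def)
      then show ?thesis using that True by simp
    next
      case False
      then show ?thesis using v(1) B by (simp add: cspan_iff)
    qed
    then show "v \<in> cspan {b \<in> B. l b = c}" using B by (simp add: cspan_iff)
  next
    fix v assume "v \<in> cspan {b \<in> B. l b = c}"
    then have v: "v x = 0" if "\<not> (x \<in> B \<and> l x = c)" for x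
      using B that by (simp add: cspan_iff)
    then have "v \<in> cspan B" using B by (simp add: cspan_iff)
    moreover from this have "L v = cscale c v"
      using v by (auto simp: fun_eq_iff Lv cscale_def)
    ultimately show "v \<in> eigenspace (cspan B) L c" by (simp add: eigenspace_def)
  qed
qed

lemma diagonal_eigenvalues:
  assumes B: "finite B" and L: "linear_map cscale (cspan B) cscale (cspan B) L"
    and diag: "\<And>b. b \<in> B \<Longrightarrow> L (bas b) = cscale (l b) (bas b)"
  shows "eigenvalues (cspan B) L = l ` B"
proof -
  have "(\<exists>v\<in>cspan {b \<in> B. l b = c}. v \<noteq> 0) \<longleftrightarrow> c \<in> l ` B" for c
  proof
    assume "\<exists>v\<in>cspan {b \<in> B. l b = c}. v \<noteq> 0"
    then obtain v b where "v \<in> cspan {b \<in> B. l b = c}" "v b \<noteq> 0" by (auto simp: fun_eq_iff)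
    then have "b \<in> {b \<in> B. l b = c}" using B cspan_iff[of "{b \<in> B. l b = c}" v] by auto
    then show "c \<in> l ` B" by auto
  next
    assume "c \<in> l ` B"
    then obtain b where b: "b \<in> B" "l b = c" by auto
    have "bas b \<noteq> 0" by (auto simp: bas_def fun_eq_iff)
    then show "\<exists>v\<in>cspan {b \<in> B. l b = c}. v \<noteq> 0"
      using b bas_in_cspan[of b "{b \<in> B. l b = c}"] by auto
  qed
  moreover have "eigenspace (cspan B) L c = cspan {b \<in> B. l b = c}" for c
    using diag by (rule diagonal_eigenspace[OF B L])
  ultimately show ?thesis by (simp add: eigenvalues_def)
qed

section \<open>Comodule maps characterized by their eigenspaces\<close>

text \<open>The first conjunct expresses diagonalizability. The second alone does not suffice: on
  the group {1, g} of order two, the map sending 1 to 0 and g to 1 has 0 as its only eigenvalue,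
  with eigenspace spanned by the class of 1, but is not diagonal.\<close>

theorem lemma4p12:
  fixes G :: "('a, 'r) monoid_scheme" (structure)
    and L :: "('a \<Rightarrow> complex) \<Rightarrow> ('a \<Rightarrow> complex)"
  assumes "group G" and "finite (carrier G)"
    and "linear_map cscale (cspan (carrier G)) cscale (cspan (carrier G)) L"
  shows "left_comodule_map (D_dual G) (carrier G) (conj_coaction G) (carrier G) (conj_coaction G) L
    \<longleftrightarrow>
      is_direct_sum (eigenvalues (cspan (carrier G)) L) (eigenspace (cspan (carrier G)) L)
        (cspan (carrier G)) \<and>
      (\<forall>c \<in> eigenvalues (cspan (carrier G)) L.
         \<exists>\<K> \<subseteq> conj_classes G. is_direct_sum \<K> cspan (eigenspace (cspan (carrier G)) L c))"
    (is "_ \<longleftrightarrow> ?sum \<and> ?classes")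
proof -
  interpret group G by fact
  note fin = assms(2) and L = assms(3)
  let ?E = "eigenspace (cspan (carrier G)) L"
  show ?thesis
    unfolding left_comodule_map_conj_coaction_iff[OF fin L]
  proof
    assume "\<exists>l. (\<forall>g\<in>carrier G. L (bas g) = cscale (l g) (bas g)) \<and>
      (\<forall>f\<in>carrier G. \<forall>g\<in>carrier G. l (f \<otimes> g \<otimes> inv f) = l g)"
    then obtain l where diag: "\<And>g. g \<in> carrier G \<Longrightarrow> L (bas g) = cscale (l g) (bas g)"
      and const: "\<And>f g. f \<in> carrier G \<Longrightarrow> g \<in> carrier G \<Longrightarrow> l (f \<otimes> g \<otimes> inv f) = l g"
      by blast
    have E: "?E c = cspan {g \<in> carrier G. l g = c}" for c
      using diag by (rule diagonal_eigenspace[OF fin L])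
    have ev: "eigenvalues (cspan (carrier G)) L = l ` carrier G"
      using diag by (rule diagonal_eigenvalues[OF fin L])
    have ?sum
    proof -
      \<comment> \<open>The level sets of \<open>l\<close> are disjoint and cover the group.\<close>
      have "is_direct_sum (l ` carrier G) (\<lambda>c. cspan {g \<in> carrier G. l g = c})
          (cspan (\<Union>c\<in>l ` carrier G. {g \<in> carrier G. l g = c}))"
        using fin by (intro is_direct_sum_cspan) (auto simp: disjoint_family_on_def)
      also have "(\<Union>c\<in>l ` carrier G. {g \<in> carrier G. l g = c}) = carrier G" by auto
      finally show ?thesis by (simp add: E ev cong: is_direct_sum_cong)
    qed
    moreover have ?classes
    proof
      fix c
      \<comment> \<open>The classes contained in the level set of c; as \<open>l\<close> is constant
        on classes, they exhaust it.\<close>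
      let ?K = "{C \<in> conj_classes G. \<forall>g\<in>C. l g = c}"
      have "is_direct_sum ?K cspan (cspan (\<Union>C\<in>?K. C))"
      proof (rule is_direct_sum_cspan)
        show "finite ?K" using finite_conj_classes[OF fin] by simp
        show "finite C" if "C \<in> ?K" for C
          using that fin conj_class_subset_carrier finite_subset by blast
        show "disjoint_family_on (\<lambda>C. C) ?K"
          using disjoint_conj_classes by (auto simp: disjoint_family_on_def disjoint_def)
      qed
      also have "(\<Union>C\<in>?K. C) = {g \<in> carrier G. l g = c}"
      proof (intro equalityI subsetI)
        fix g assume "g \<in> (\<Union>C\<in>?K. C)"
        then show "g \<in> {g \<in> carrier G. l g = c}" using conj_class_subset_carrier by auto
      next
        fix g assume g: "g \<in> {g \<in> carrier G. l g = c}"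
        then obtain C where C: "C \<in> conj_classes G" "g \<in> C"
          using Union_conj_classes by blast
        have "l h = c" if h: "h \<in> C" for h
        proof -
          obtain f where "f \<in> carrier G" "h = f \<otimes> g \<otimes> inv f"
            using conj_classE[OF C h] .
          then show ?thesis using const g by simp
        qed
        then show "g \<in> (\<Union>C\<in>?K. C)" using C by blast
      qed
      finally show "\<exists>\<K> \<subseteq> conj_classes G. is_direct_sum \<K> cspan (?E c)"
        unfolding E by (intro exI[of _ ?K] conjI) auto
    qed
    ultimately show "?sum \<and> ?classes" ..
  next
    assume asm: "?sum \<and> ?classes"
    \<comment> \<open>Some eigencomponent w of \<open>bas g\<close> is nonzero at g, and in turn
      some class component u of w is nonzero at g. Hence g lies in that class C, and since
      \<open>cspan C\<close> is contained in the eigenspace, all of C shares the eigenvalue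
      c.\<close>
    have ex: "\<exists>c C. C \<in> conj_classes G \<and> g \<in> C \<and> (\<forall>h\<in>C. L (bas h) = cscale c (bas h))"
      if g: "g \<in> carrier G" for g
    proof -
      have "bas g g \<noteq> 0" by (simp add: bas_def)
      then obtain c w where c: "c \<in> eigenvalues (cspan (carrier G)) L"
        and w: "w \<in> ?E c" "w g \<noteq> 0"
        using is_direct_sum_nonzero_coordE[OF conjunct1[OF asm] bas_in_cspan[OF g]] by blast
      obtain \<K> where \<K>: "\<K> \<subseteq> conj_classes G" and sum: "is_direct_sum \<K> cspan (?E c)"
        using asm c by blast
      obtain C u where C: "C \<in> \<K>" and u: "u \<in> cspan C" "u g \<noteq> 0"
        using is_direct_sum_nonzero_coordE[OF sum w] .
      have "finite C" using C \<K> fin conj_class_subset_carrier finite_subset by blast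
      then have "g \<in> C" using u by (auto simp: cspan_iff)
      moreover have "L (bas h) = cscale c (bas h)" if "h \<in> C" for h
        using is_direct_sum_component_subset[OF sum C] bas_in_cspan[OF that]
        by (auto simp: eigenspace_def)
      ultimately show ?thesis using C \<K> by blast
    qed
    \<comment> \<open>Reading the eigenvalue off the diagonal makes it independent of the c and C
      chosen for g.\<close>
    define l where "l g = L (bas g) g" for g
    have l: "l g = c" if "L (bas g) = cscale c (bas g)" for g c
      using that by (simp add: l_def cscale_def bas_def)
    have "L (bas g) = cscale (l g) (bas g)" if "g \<in> carrier G" for g
      using ex[OF that] l by metis
    moreover have "l (f \<otimes> g \<otimes> inv f) = l g" if f: "f \<in> carrier G" and g: "g \<in> carrier G" for f g
    proof -
      \<comment> \<open>g and its conjugate both lie in C, so the same c is the diagonal entry at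
        each.\<close>
      obtain c C where "C \<in> conj_classes G" "g \<in> C" "\<forall>h\<in>C. L (bas h) = cscale c (bas h)"
        using ex[OF g] by blast
      then show ?thesis using l conj_class_closed[OF _ _ f] by metis
    qed
    ultimately show "\<exists>l. (\<forall>g\<in>carrier G. L (bas g) = cscale (l g) (bas g)) \<and>
      (\<forall>f\<in>carrier G. \<forall>g\<in>carrier G. l (f \<otimes> g \<otimes> inv f) = l g)" by blast
  qed
qed

end
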